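(* Let $q$ be a prime power, $2\le n\le m$, $\mathcal{C}\subseteq\mathrm{Mat}$ a non-zero rank-metric code, and $1\le i\le\dim(\mathcal{C})$ an integer. If $m>n$, then $a_i(\mathcal{C})=\min\{n-\dim(J)\mid J\subseteq\mathbb{F}_q^n\text{ a subspace},\ \dim(\mathcal{C})-m\rho_{\mathrm c}(\mathcal{C},J)\ge i\}$. If $n=m$, then $a_i(\mathcal{C})=\min\{a_i(\mathcal{C},\mathrm c),a_i(\mathcal{C},\mathrm r)\}$, where $a_i(\mathcal{C},\mathrm c)=\min\{n-\dim(J)\mid J\subseteq\mathbb{F}_q^n,\ \dim(\mathcal{C})-m\rho_{\mathrm c}(\mathcal{C},J)\ge i\}$ and $a_i(\mathcal{C},\mathrm r)=\min\{m-\dim(K)\mid K\subseteq\mathbb{F}_q^m,\ \dim(\mathcal{C})-n\rho_{\mathrm r}(\mathcal{C},K)\ge i\}$.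
   Context: $\mathrm{Mat}$ is the $\mathbb{F}_q$-space of $n\times m$ matrices over $\mathbb{F}_q$; a rank-metric code is an $\mathbb{F}_q$-linear subspace. For a code $\mathcal{A}$, $\mathrm{maxrk}(\mathcal{A})=\max\{\mathrm{rk}(M)\mid M\in\mathcal{A}\}$, and $\mathcal{A}$ is an optimal anticode if $\dim\mathcal{A}=m\cdot\mathrm{maxrk}(\mathcal{A})$. The $i$-th generalized weight of a non-zero code is $a_i(\mathcal{C})=\frac1m\min\{\dim\mathcal{A}\mid\mathcal{A}\subseteq\mathrm{Mat}\text{ optimal anticode},\ \dim(\mathcal{C}\cap\mathcal{A})\ge i\}$. For subspaces $J\subseteq\mathbb{F}_q^n$, $K\subseteq\mathbb{F}_q^m$: $\mathcal{C}(J,\mathrm c)=\{M\in\mathcal{C}\mid\mathrm{colsp}(M)\subseteq J\}$, $\mathcal{C}(K,\mathrm r)=\{M\in\mathcal{C}\mid\mathrm{rowsp}(M)\subseteq K\}$, $\rho_{\mathrm c}(\mathcal{C},J)=(\dim\mathcal{C}-\dim\mathcal{C}(J^\perp,\mathrm c))/m$, $\rho_{\mathrm r}(\mathcal{C},K)=(\dim\mathcal{C}-\dim\mathcal{C}(K^\perp,\mathrm r))/n$ ($\perp$ for the standard inner product). *)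

theory Defs
  imports "HOL-Analysis.Analysis"
begin

text \<open>Matrices in Mat = n x m matrices over the finite field 'a = F_q are elements of
  type 'a^'m^'n (rows indexed by 'n, columns by 'm); n = CARD('n), m = CARD('m).
  Mat is an F_q-vector space via entrywise scalar multiplication.\<close>

definition mscale :: "'a::field \<Rightarrow> 'a^'m^'n \<Rightarrow> 'a^'m^'n" where
  "mscale c A = (\<chi> i j. c * A $ i $ j)"

interpretation mat: vector_space "mscale :: 'a::field \<Rightarrow> 'a^'m^'n \<Rightarrow> 'a^'m^'n"
  by unfold_locales (simp_all add: mscale_def vec_eq_iff algebra_simps)

text \<open>Rank-metric code: an F_q-linear subspace of Mat; its dimension is mat.dim.\<close>

definition maxrk :: "('a::field^'m^'n) set \<Rightarrow> nat" where
  "maxrk A = Max (rank ` A)"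

definition optimal_anticode :: "('a::field^'m^'n) set \<Rightarrow> bool" where
  "optimal_anticode A \<longleftrightarrow> mat.subspace A \<and> mat.dim A = CARD('m) * maxrk A"

definition gen_weight :: "('a::field^'m^'n) set \<Rightarrow> nat \<Rightarrow> real" where
  "gen_weight C i = real (Min {mat.dim A | A. optimal_anticode A \<and> mat.dim (C \<inter> A) \<ge> i})
                     / real CARD('m)"

definition dotp :: "'a::field^'k \<Rightarrow> 'a^'k \<Rightarrow> 'a" where
  "dotp x y = (\<Sum>k\<in>UNIV. x $ k * y $ k)"

definition orth :: "('a::field^'k) set \<Rightarrow> ('a^'k) set" where
  "orth J = {x. \<forall>y\<in>J. dotp x y = 0}"

definition colsp :: "'a::field^'m^'n \<Rightarrow> ('a^'n) set" where
  "colsp M = vec.span (columns M)"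

definition rowsp :: "'a::field^'m^'n \<Rightarrow> ('a^'m) set" where
  "rowsp M = vec.span (rows M)"

definition subcode_c :: "('a::field^'m^'n) set \<Rightarrow> ('a^'n) set \<Rightarrow> ('a^'m^'n) set" where
  "subcode_c C J = {M \<in> C. colsp M \<subseteq> J}"

definition subcode_r :: "('a::field^'m^'n) set \<Rightarrow> ('a^'m) set \<Rightarrow> ('a^'m^'n) set" where
  "subcode_r C K = {M \<in> C. rowsp M \<subseteq> K}"

definition rho_c :: "('a::field^'m^'n) set \<Rightarrow> ('a^'n) set \<Rightarrow> real" where
  "rho_c C J = (real (mat.dim C) - real (mat.dim (subcode_c C (orth J)))) / real CARD('m)"

definition rho_r :: "('a::field^'m^'n) set \<Rightarrow> ('a^'m) set \<Rightarrow> real" where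
  "rho_r C K = (real (mat.dim C) - real (mat.dim (subcode_r C (orth K)))) / real CARD('n)"

definition gen_weight_c :: "('a::field^'m^'n) set \<Rightarrow> nat \<Rightarrow> real" where
  "gen_weight_c C i = real (Min {CARD('n) - vec.dim J | J :: ('a^'n) set.
      vec.subspace J \<and> real (mat.dim C) - real CARD('m) * rho_c C J \<ge> real i})"

definition gen_weight_r :: "('a::field^'m^'n) set \<Rightarrow> nat \<Rightarrow> real" where
  "gen_weight_r C i = real (Min {CARD('m) - vec.dim K | K :: ('a^'m) set.
      vec.subspace K \<and> real (mat.dim C) - real CARD('n) * rho_r C K \<ge> real i})"

end

theory Submission
  imports Defs
begin

text \<open>
  The theorem reduces to the classification of optimal anticodes (Dieudonne, Meshulam): such a
  code consists of all matrices with column space in a fixed \<open>J\<close> or, if \<open>n = m\<close>, of all matrices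
  with row space in a fixed \<open>K\<close>. Let \<open>W\<close> have dimension \<open>mr\<close> and all ranks at most \<open>r\<close>.

  For a basis \<open>x 0, x 1, \<dots>\<close> of \<open>F\<^sup>m\<close> let \<open>S k\<close> be the space of values \<open>M (x k)\<close> of those \<open>M\<close> in \<open>W\<close>
  that kill \<open>x 0, \<dots>, x (k - 1)\<close>, so that the dimensions of the \<open>S k\<close> add up to \<open>mr\<close>. An independent
  transversal of the \<open>S k\<close> yields a matrix of at least that rank in \<open>W\<close>, and a greedy choice of
  transversals forces all \<open>S k\<close> to have dimension \<open>r\<close>, or \<open>n = m\<close> and dimensions in \<open>{0, n}\<close>.

  If \<open>r\<close> always occurs, then \<open>Wx = Wy\<close> for independent \<open>x\<close>, \<open>y\<close>, because both spaces are attained on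
  the matrices killing \<open>x - y\<close>; so \<open>J = Wx\<close> does not depend on \<open>x\<close>. The two alternatives cannot occur
  together when \<open>0 < r < n\<close>, and if every \<open>Wx\<close> is zero or everything, counting the pairs \<open>(M, x)\<close> with
  \<open>Mx = 0\<close> shows that the common kernel of \<open>W\<close> has dimension at least \<open>n - r\<close>.
\<close>

section \<open>Linear algebra over finite fields\<close>

lemma (in vector_space) card_span_independent:
  assumes "finite (UNIV :: 'a set)" "finite B" "independent B"
  shows "card (span B) = CARD('a) ^ card B"
  using assms(2,3)
proof (induction B rule: finite_induct)
  case empty
  then show ?case by simp
next
  case (insert b B)
  have ind: "independent B" and b: "b \<notin> span B"
    using insert.prems insert.hyps(2) by (auto simp: independent_insert)
  let ?g = "\<lambda>(c, v). scale c b + v"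
  have "span (insert b B) = ?g ` (UNIV \<times> span B)"
  proof (intro subset_antisym subsetI)
    fix x assume "x \<in> span (insert b B)"
    then obtain k where "x - scale k b \<in> span B"
      by (auto simp: span_breakdown_eq)
    then show "x \<in> ?g ` (UNIV \<times> span B)"
      by (intro image_eqI[of _ _ "(k, x - scale k b)"]) auto
  next
    show "x \<in> span (insert b B)" if "x \<in> ?g ` (UNIV \<times> span B)" for x
      using that by (auto intro!: span_add span_scale intro: span_base span_mono[THEN subsetD, of B])
  qed
  moreover have "inj_on ?g (UNIV \<times> span B)"
  proof (rule inj_onI, clarify)
    fix c v d w
    assume v: "v \<in> span B" and w: "w \<in> span B" and eq: "scale c b + v = scale d b + w"
    have e: "scale (c - d) b = w - v"
      using eq by (simp add: scale_left_diff_distrib algebra_simps)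
    then have "scale (c - d) b \<in> span B"
      using v w by (simp add: span_diff)
    then have "c = d"
      using b by (metis right_minus_eq span_scale scale_scale left_inverse scale_one)
    then show "c = d \<and> v = w"
      using eq by simp
  qed
  ultimately have "card (span (insert b B)) = CARD('a) * card (span B)"
    by (simp add: card_image card_cartesian_product)
  then show ?case
    using insert ind by simp
qed

text \<open>Over a finite field the cardinality determines the dimension. Dimensions of matrix
  spaces can therefore be compared by counting, without exhibiting a basis.\<close>

lemma (in vector_space) card_subspace:
  assumes "finite (UNIV :: 'a set)" "finite S" "subspace S"
  shows "card S = CARD('a) ^ dim S"
proof -
  obtain B where B: "B \<subseteq> S" "independent B" "S \<subseteq> span B" "card B = dim S"
    using basis_exists by blast
  then have "span B = S"
    using assms(3) by (simp add: span_minimal subset_antisym)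
  then show ?thesis
    using card_span_independent[OF assms(1) finite_subset[OF B(1) assms(2)] B(2)] B(4) by simp
qed

text \<open>The fibre through \<open>u\<close> is the kernel translated by \<open>u\<close>, so all
  non-empty fibres have the same size.\<close>

lemma (in Vector_Spaces.linear) card_kernel_image:
  assumes V: "vs1.subspace V" and fin: "finite V"
  shows "card V = card {v \<in> V. f v = 0} * card (f ` V)"
proof -
  have fibre: "card {v \<in> V. f v = f u} = card {v \<in> V. f v = 0}" if u: "u \<in> V" for u
  proof (rule bij_betw_same_card)
    show "bij_betw (\<lambda>v. v - u) {v \<in> V. f v = f u} {v \<in> V. f v = 0}"
      by (rule bij_betw_byWitness[where f' = "\<lambda>v. v + u"])
        (use V u in \<open>auto simp: diff add vs1.subspace_diff vs1.subspace_add\<close>)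
  qed
  have "card V = (\<Sum>w\<in>f ` V. card {v \<in> V. f v = w})"
    using sum.image_gen[OF fin, of "\<lambda>_. 1::nat" f] by simp
  also have "\<dots> = (\<Sum>w\<in>f ` V. card {v \<in> V. f v = 0})"
    by (intro sum.cong refl) (auto simp: fibre)
  finally show ?thesis by (simp add: mult.commute)
qed

lemma CARD_field_gt_1: "1 < CARD('a::{finite,field})"
proof -
  have "card {0, 1 :: 'a} \<le> CARD('a)" by (rule card_mono) auto
  then show ?thesis by simp
qed

lemma (in Vector_Spaces.linear) dim_kernel_image:
  assumes V: "vs1.subspace V" and fin: "finite V" and fa: "finite (UNIV :: 'a set)"
  shows "vs1.dim V = vs1.dim {v \<in> V. f v = 0} + vs2.dim (f ` V)"
proof -
  have "card {0, 1 :: 'a} \<le> CARD('a)" by (rule card_mono) (auto simp: fa)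
  then have q: "1 < CARD('a)" by simp
  have ker: "vs1.subspace {v \<in> V. f v = 0}"
    using V by (auto simp: vs1.subspace_def add scale)
  have img: "vs2.subspace (f ` V)"
    by (rule subspace_image[OF V])
  have "CARD('a) ^ vs1.dim V = CARD('a) ^ (vs1.dim {v \<in> V. f v = 0} + vs2.dim (f ` V))"
    using card_kernel_image[OF V fin] vs1.card_subspace[OF fa _ ker] vs1.card_subspace[OF fa fin V]
      vs2.card_subspace[OF fa _ img] fin by (simp add: power_add)
  then show ?thesis
    using q power_inject_exp by blast
qed

section \<open>Row rank, column rank and kernels\<close>

text \<open>Expand every row in a basis \<open>B\<close> of the row space. Reading the expansions at
  coordinate \<open>j\<close> exhibits column \<open>j\<close> as a combination of the
  \<open>card B\<close> coefficient vectors, with weights \<open>b $ j\<close>. The transpose gives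
  the reverse inequality.\<close>

lemma dim_columns_le_dim_rows: "vec.dim (columns A) \<le> vec.dim (rows A)"
  for A :: "'a::field^'m^'n"
proof -
  obtain B where B: "B \<subseteq> rows A" "vec.independent B" "rows A \<subseteq> vec.span B" "card B = vec.dim (rows A)"
    using vec.basis_exists by blast
  have finB: "finite B"
    using B(2) by (rule vec.finiteI_independent)
  have "\<exists>u. (\<Sum>b\<in>B. u b *s b) = A $ i" for i
  proof -
    have "A $ i \<in> rows A" by (auto simp: rows_def row_def)
    then have "A $ i \<in> vec.span B" using B(3) by blast
    then show ?thesis by (auto simp: vec.span_finite[OF finB])
  qed
  then obtain u where u: "\<And>i. (\<Sum>b\<in>B. u i b *s b) = A $ i" by metis
  have "column j A \<in> vec.span ((\<lambda>b. \<chi> i. u i b) ` B)" for j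
  proof -
    have "column j A = (\<Sum>b\<in>B. b $ j *s (\<chi> i. u i b))"
      by (simp add: vec_eq_iff column_def flip: u) (simp add: mult.commute)
    also have "\<dots> \<in> vec.span ((\<lambda>b. \<chi> i. u i b) ` B)"
      by (intro vec.span_sum vec.span_scale vec.span_base) auto
    finally show ?thesis .
  qed
  then have "vec.dim (columns A) \<le> card ((\<lambda>b. \<chi> i. u i b) ` B)"
    using finB by (intro vec.dim_le_card) (auto simp: columns_def)
  then show ?thesis
    using card_image_le[OF finB, of "\<lambda>b. \<chi> i. u i b"] B(4) by (simp add: le_trans)
qed

lemma rank_eq_dim_columns: "rank A = vec.dim (columns A)" for A :: "'a::field^'m^'n"
  using dim_columns_le_dim_rows[of A] dim_columns_le_dim_rows[of "transpose A"]
  by (simp add: row_rank_def_gen)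

lemma column_eq_mult_axis: "column j A = A *v axis j 1" for A :: "'a::field^'m^'n"
  by (simp add: vec_eq_iff column_def matrix_vector_mult_def axis_def if_distrib cong: if_cong)

lemma rank_eq_dim_range: "rank A = vec.dim (range ((*v) A))" for A :: "'a::field^'m^'n"
proof -
  have "range ((*v) A) = vec.span (columns A)"
  proof (intro subset_antisym subsetI)
    fix y assume "y \<in> range ((*v) A)"
    then show "y \<in> vec.span (columns A)"
      using matrix_vector_mult_in_columnspace_gen by blast
  next
    have "columns A \<subseteq> range ((*v) A)"
      by (auto simp: columns_def column_eq_mult_axis)
    moreover have "vec.subspace (range ((*v) A))"
      using vec.subspace_image[OF vec.subspace_UNIV] .
    ultimately show "y \<in> range ((*v) A)" if "y \<in> vec.span (columns A)" for y
      using that vec.span_minimal by blast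
  qed
  then show ?thesis by (simp add: rank_eq_dim_columns)
qed

lemma rank_nullity: "vec.dim {x. A *v x = 0} + rank A = CARD('m)"
  for A :: "'a::{finite,field}^'m^'n"
  using linear.dim_kernel_image[OF matrix_vector_mul_linear_gen vec.subspace_UNIV, of A]
  by (simp add: rank_eq_dim_range vec_dim_card card_cart_basis)

text \<open>A basis is padded with zeros to a family indexed by \<open>'l\<close>. Such families
  serve as the rows or columns of matrices of rank \<open>vec.dim J\<close>.\<close>

lemma subspace_span_range:
  fixes J :: "('a::field^'k) set"
  assumes "vec.subspace J" "vec.dim J \<le> CARD('l)"
  obtains g :: "'l::finite \<Rightarrow> 'a^'k" where "vec.span (range g) = J"
proof -
  obtain B where B: "B \<subseteq> J" "vec.independent B" "J \<subseteq> vec.span B" "card B = vec.dim J"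
    using vec.basis_exists by blast
  have finB: "finite B"
    using B(2) by (rule vec.finiteI_independent)
  obtain h :: "'a^'k \<Rightarrow> 'l" where h: "inj_on h B"
    using card_le_inj[OF finB, of "UNIV :: 'l set"] B(4) assms(2) by auto
  define g where "g l = (if l \<in> h ` B then the_inv_into B h l else 0)" for l
  have "b \<in> range g" if "b \<in> B" for b
    by (rule range_eqI[of _ _ "h b"]) (use that h in \<open>simp add: g_def the_inv_into_f_f\<close>)
  moreover have "g l \<in> insert 0 B" for l
    using h by (auto simp: g_def the_inv_into_f_f)
  ultimately have "B \<subseteq> range g" "range g \<subseteq> insert 0 B" by auto
  then have "vec.span (range g) = vec.span B"
    by (metis vec.span_insert_0 vec.span_mono subset_antisym)
  moreover have "vec.span B = J"
    using B assms(1) by (simp add: vec.span_minimal subset_antisym)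
  ultimately show ?thesis using that by simp
qed

section \<open>Orthogonal complements\<close>

lemma dotp_commute: "dotp x y = dotp y x"
  by (simp add: dotp_def mult.commute)

lemma subspace_orth: "vec.subspace (orth J)"
  by (auto simp: vec.subspace_def orth_def dotp_def algebra_simps sum.distrib simp flip: sum_distrib_left)

lemma orth_span: "orth (vec.span S) = orth S"
proof (intro subset_antisym subsetI)
  show "x \<in> orth S" if "x \<in> orth (vec.span S)" for x
    using that by (auto simp: orth_def vec.span_base)
next
  fix x assume "x \<in> orth S"
  then have "S \<subseteq> orth {x}" by (auto simp: orth_def dotp_commute)
  then have "vec.span S \<subseteq> orth {x}" by (rule vec.span_minimal[OF _ subspace_orth])
  then show "x \<in> orth (vec.span S)" by (auto simp: orth_def dotp_commute)
qed

lemma matrix_vector_mult_eq_0_iff: "A *v x = 0 \<longleftrightarrow> x \<in> orth (rows A)"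
  for A :: "'a::field^'m^'n"
  by (auto simp: vec_eq_iff matrix_vector_mult_def orth_def dotp_def rows_def row_def mult.commute)

lemma dim_orth:
  fixes J :: "('a::{finite,field}^'k) set"
  assumes "vec.subspace J"
  shows "vec.dim (orth J) + vec.dim J = CARD('k)"
proof -
  have "vec.dim J \<le> CARD('k)" by (rule dim_subset_UNIV_cart_gen)
  then obtain g :: "'k \<Rightarrow> 'a^'k" where g: "vec.span (range g) = J"
    by (rule subspace_span_range[OF assms])
  define A where "A = (\<chi> i. g i)"
  have rows: "rows A = range g"
    by (auto simp: A_def rows_def row_def vec_eq_iff image_def)
  have "orth J = {x. A *v x = 0}"
    using orth_span[of "range g"] by (auto simp: g matrix_vector_mult_eq_0_iff rows)
  moreover have "rank A = vec.dim J"
    by (metis g row_rank_def_gen rows vec.dim_span)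
  ultimately show ?thesis
    using rank_nullity[of A] by simp
qed

lemma orth_orth:
  fixes J :: "('a::{finite,field}^'k) set"
  assumes "vec.subspace J"
  shows "orth (orth J) = J"
proof (rule sym, rule vec.subspace_dim_equal[OF assms subspace_orth])
  show "J \<subseteq> orth (orth J)" by (auto simp: orth_def dotp_commute)
  show "vec.dim (orth (orth J)) \<le> vec.dim J"
    using dim_orth[OF assms] dim_orth[OF subspace_orth, of J] by simp
qed

section \<open>Flags and ranks\<close>

lemma linear_matrix_eval: "Vector_Spaces.linear mscale (*s) (\<lambda>M :: 'a::field^'m^'n. M *v x)"
  by unfold_locales
    (simp_all add: vec_eq_iff mscale_def matrix_vector_mult_def algebra_simps sum.distrib sum_distrib_left)

definition vanishing :: "('a::field^'m^'n) set \<Rightarrow> (nat \<Rightarrow> 'a^'m) \<Rightarrow> nat \<Rightarrow> ('a^'m^'n) set" where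
  "vanishing W x k = {M \<in> W. \<forall>i<k. M *v x i = 0}"

text \<open>The dimension of the space \<open>S k\<close> of the overview; by rank-nullity it is the
  drop in dimension at step \<open>k\<close> of the filtration \<open>vanishing W x\<close>.\<close>

definition jump :: "('a::field^'m^'n) set \<Rightarrow> (nat \<Rightarrow> 'a^'m) \<Rightarrow> nat \<Rightarrow> nat" where
  "jump W x k = vec.dim ((\<lambda>M. M *v x k) ` vanishing W x k)"

lemma mscale_matrix_vector: "mscale c M *v x = c *s (M *v x)" for M :: "'a::field^'m^'n"
  using linear_matrix_eval[of x] unfolding Vector_Spaces.linear_iff by blast

lemma subspace_vanishing: "mat.subspace W \<Longrightarrow> mat.subspace (vanishing W x k)"
  by (auto simp: mat.subspace_def vanishing_def matrix_vector_mult_add_rdistrib mscale_matrix_vector)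

lemma subspace_eval_image:
  assumes "mat.subspace W"
  shows "vec.subspace ((\<lambda>M. M *v x) ` W)"
proof -
  interpret L: Vector_Spaces.linear mscale "(*s)" "\<lambda>M :: 'a::field^'b^'c. M *v x"
    by (rule linear_matrix_eval)
  show ?thesis by (rule L.subspace_image[OF assms])
qed

lemma dim_vanishing_Suc:
  fixes W :: "('a::{finite,field}^'m^'n) set"
  assumes "mat.subspace W"
  shows "mat.dim (vanishing W x k) = mat.dim (vanishing W x (Suc k)) + jump W x k"
proof -
  have "{M \<in> vanishing W x k. M *v x k = 0} = vanishing W x (Suc k)"
    by (auto simp: vanishing_def less_Suc_eq)
  then show ?thesis
    using linear.dim_kernel_image[OF linear_matrix_eval subspace_vanishing[OF assms],
        of x k "x k"]
    by (simp add: jump_def)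
qed

lemma vanishing_spanning:
  fixes W :: "('a::field^'m^'n) set"
  assumes "mat.subspace W" "vec.span (x ` {..<k}) = UNIV"
  shows "vanishing W x k = {0}"
proof -
  have "M = 0" if "M \<in> vanishing W x k" for M
  proof -
    have "x ` {..<k} \<subseteq> {v. M *v v = 0}" using that by (auto simp: vanishing_def)
    then have "vec.span (x ` {..<k}) \<subseteq> {v. M *v v = 0}"
      by (rule vec.span_minimal)
        (auto simp: vec.subspace_def matrix_vector_right_distrib vec.scale)
    then show "M = 0" using assms(2) by (auto simp: matrix_eq)
  qed
  moreover have "0 \<in> vanishing W x k"
    using mat.subspace_0[OF assms(1)] by (simp add: vanishing_def)
  ultimately show ?thesis by auto
qed

text \<open>The drops telescope: the filtration starts at \<open>W\<close> and ends at
  \<open>{0}\<close>.\<close>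

lemma sum_jump:
  fixes W :: "('a::{finite,field}^'m^'n) set"
  assumes "mat.subspace W" "vec.span (x ` {..<k}) = UNIV"
  shows "(\<Sum>j<k. jump W x j) = mat.dim W"
proof -
  have "(\<Sum>j<l. jump W x j) + mat.dim (vanishing W x l) = mat.dim W" for l
  proof (induction l)
    case 0
    then show ?case by (simp add: vanishing_def)
  next
    case (Suc l)
    then show ?case using dim_vanishing_Suc[OF assms(1), of x l] by simp
  qed
  moreover have "mat.dim ({0} :: ('a^'m^'n) set) = 0"
    by (metis mat.dim_le_card card.empty finite.emptyI le_zero_eq mat.span_empty order_refl)
  ultimately show ?thesis
    by (metis vanishing_spanning[OF assms] add_0_right)
qed

section \<open>Independent transversals\<close>

lemma dim_image_le_card: "finite A \<Longrightarrow> vec.dim (f ` A) \<le> card A"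
  for f :: "'i \<Rightarrow> 'a::field^'n"
  using vec.dim_le_card[OF vec.span_superset, of "f ` A"] card_image_le[of A f] by simp

text \<open>That the image of \<open>B\<close> has dimension \<open>card B\<close> says at once that
  \<open>f\<close> is injective on \<open>B\<close> and that its values are independent. Such a
  family survives the exchange of one member for a vector outside the span of the others.\<close>

lemma dim_image_replace:
  fixes f g :: "'i \<Rightarrow> 'a::field^'n"
  assumes "finite B" "s \<in> B" "vec.dim (f ` B) = card B" "\<And>j. j \<in> B - {s} \<Longrightarrow> g j = f j"
    and "g s \<notin> vec.span (f ` (B - {s}))"
  shows "vec.dim (g ` B) = card B"
proof -
  have "f ` B = insert (f s) (f ` (B - {s}))"
    using assms(2) by auto
  then have "card B \<le> Suc (vec.dim (f ` (B - {s})))"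
    using assms(3) vec.dim_insert[of "f s" "f ` (B - {s})"] by (simp split: if_splits)
  moreover have "vec.dim (f ` (B - {s})) \<le> card (B - {s})"
    using assms(1) by (intro dim_image_le_card) simp
  moreover have "Suc (card (B - {s})) = card B"
    using card_Suc_Diff1[OF assms(1,2)] by simp
  moreover have "g ` B = insert (g s) (g ` (B - {s}))"
    using assms(2) by auto
  moreover have "g ` (B - {s}) = f ` (B - {s})"
    using assms(4) by (intro image_cong) auto
  ultimately show ?thesis
    using assms(5) by (simp add: vec.dim_insert)
qed

lemma not_in_span_of_independent_image:
  fixes f :: "'i \<Rightarrow> 'a::field^'n"
  assumes "finite B" "s \<in> B" "vec.dim (f ` B) = card B"
  shows "f s \<notin> vec.span (f ` (B - {s}))"
proof
  assume "f s \<in> vec.span (f ` (B - {s}))"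
  moreover have "f ` B = insert (f s) (f ` (B - {s}))"
    using assms(2) by auto
  ultimately have "card B = vec.dim (f ` (B - {s}))"
    using assms(3) vec.dim_insert[of "f s" "f ` (B - {s})"] by simp
  also have "\<dots> \<le> card (B - {s})"
    using assms(1) by (intro dim_image_le_card) simp
  finally show False
    using card_Suc_Diff1[OF assms(1,2)] by simp
qed

text \<open>The prescribed values \<open>v j\<close> are traded one by one, in increasing order of
  \<open>j\<close>, for values of a single matrix of \<open>W\<close>, keeping the family
  independent.\<close>

lemma rank_ge_transversal:
  fixes W :: "('a::field^'m^'n) set"
  assumes W: "mat.subspace W" and B: "finite B"
    and v: "\<And>j. j \<in> B \<Longrightarrow> v j \<in> (\<lambda>M. M *v x j) ` vanishing W x j"
    and dim: "vec.dim (v ` B) = card B"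
  obtains M where "M \<in> W" "card B \<le> rank M"
proof -
  have "\<forall>j\<in>B. \<exists>A. A \<in> vanishing W x j \<and> v j = A *v x j"
    using v by blast
  from bchoice[OF this] obtain A where A: "\<And>j. j \<in> B \<Longrightarrow> A j \<in> vanishing W x j \<and> v j = A j *v x j"
    by blast
  \<comment> \<open>The mixed family takes actual values of \<open>M\<close> before \<open>s\<close>
    and prescribed values from \<open>s\<close> on.\<close>
  have "\<exists>M\<in>W. vec.dim ((\<lambda>l. if l < s then M *v x l else v l) ` B) = card B" for s
  proof (induction s)
    case 0
    then show ?case using dim mat.subspace_0[OF W] by auto
  next
    case (Suc s)
    then obtain M where M: "M \<in> W" and
      dimM: "vec.dim ((\<lambda>l. if l < s then M *v x l else v l) ` B) = card B" (is "vec.dim (?f ` B) = _")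
      by blast
    show ?case
    proof (cases "s \<in> B")
      case False
      then have "(\<lambda>l. if l < Suc s then M *v x l else v l) ` B = ?f ` B"
        by (intro image_cong) (auto simp: less_Suc_eq)
      then have "vec.dim ((\<lambda>l. if l < Suc s then M *v x l else v l) ` B) = card B"
        using dimM by simp
      then show ?thesis using M by blast
    next
      case s: True
      let ?R = "vec.span (?f ` (B - {s}))"
      \<comment> \<open>Adding \<open>A s\<close> does not disturb the columns before \<open>s\<close>, so the coefficient of \<open>A s\<close> only has
        to be adjusted at column \<open>s\<close>; one of 0 and 1 always works, whatever the field.\<close>
      have "v s \<notin> ?R"
        using not_in_span_of_independent_image[OF B s dimM] by simp
      then have "M *v x s \<notin> ?R \<or> (M + A s) *v x s \<notin> ?R"
        using A[OF s] vec.span_diff[of "(M + A s) *v x s" "?f ` (B - {s})" "M *v x s"]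
        by (auto simp: matrix_vector_mult_add_rdistrib)
      moreover have "M + A s \<in> W"
        using M A[OF s] W by (auto simp: vanishing_def mat.subspace_add)
      moreover have "(M + A s) *v x l = M *v x l" if "l < s" for l
        using A[OF s] that by (simp add: vanishing_def matrix_vector_mult_add_rdistrib)
      ultimately obtain N where N: "N \<in> W" "N *v x s \<notin> ?R" "\<And>l. l < s \<Longrightarrow> N *v x l = M *v x l"
        using M by blast
      have "vec.dim ((\<lambda>l. if l < Suc s then N *v x l else v l) ` B) = card B"
        by (rule dim_image_replace[OF B s dimM]) (use N in \<open>auto simp: less_Suc_eq\<close>)
      then show ?thesis using N(1) by blast
    qed
  qed
  \<comment> \<open>\<open>Suc (Max B)\<close> lies above every index in \<open>B\<close>, so by now
    the whole family consists of values of \<open>M\<close>.\<close>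
  from this[of "Suc (Max B)"] obtain M where M: "M \<in> W"
    "vec.dim ((\<lambda>l. if l < Suc (Max B) then M *v x l else v l) ` B) = card B" by blast
  have "(\<lambda>l. if l < Suc (Max B) then M *v x l else v l) ` B \<subseteq> range ((*v) M)"
    using B by (auto simp: less_Suc_eq_le)
  then have "card B \<le> rank M"
    using M(2) vec.dim_subset by (metis rank_eq_dim_range)
  then show ?thesis using that M(1) by blast
qed

text \<open>Greedy choice: one space of dimension above \<open>k\<close> is set aside, a transversal
  of size \<open>k\<close> is found among the others, and the large space cannot lie inside its
  span.\<close>

lemma independent_transversal_exists:
  fixes S :: "'i \<Rightarrow> ('a::field^'n) set"
  assumes "finite I" "\<And>a. a < k \<Longrightarrow> k - a \<le> card {j \<in> I. a < vec.dim (S j)}"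
  shows "\<exists>B\<subseteq>I. \<exists>v. card B = k \<and> (\<forall>j\<in>B. v j \<in> S j) \<and> vec.dim (v ` B) = k"
  using assms
proof (induction k arbitrary: I)
  case 0
  then show ?case by (intro exI[of _ "{}"]) auto
next
  case (Suc k)
  from Suc.prems(2)[of k] have "card {j \<in> I. k < vec.dim (S j)} \<noteq> 0" by simp
  then have "{j \<in> I. k < vec.dim (S j)} \<noteq> {}" by (metis card.empty)
  then obtain i where i: "i \<in> I" "k < vec.dim (S i)" by blast
  \<comment> \<open>The index \<open>i\<close> is counted for every threshold \<open>a < k\<close>,
    so its removal lowers each count by exactly one.\<close>
  have "k - a \<le> card {j \<in> I - {i}. a < vec.dim (S j)}" if "a < k" for a
  proof -
    have "{j \<in> I. a < vec.dim (S j)} = insert i {j \<in> I - {i}. a < vec.dim (S j)}"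
      using i that by auto
    then have "card {j \<in> I. a < vec.dim (S j)} = Suc (card {j \<in> I - {i}. a < vec.dim (S j)})"
      using Suc.prems(1) by simp
    then show ?thesis using Suc.prems(2)[of a] that by simp
  qed
  from Suc.IH[OF _ this] Suc.prems(1) obtain B v where
    B: "B \<subseteq> I - {i}" "card B = k" "\<forall>j\<in>B. v j \<in> S j" "vec.dim (v ` B) = k"
    by auto
  have "\<not> S i \<subseteq> vec.span (v ` B)"
    using i(2) B(4) vec.dim_mono by (metis not_less)
  then obtain w where w: "w \<in> S i" "w \<notin> vec.span (v ` B)" by blast
  have iB: "i \<notin> B" using B(1) by blast
  have finB: "finite B" using B(1) Suc.prems(1) finite_subset by blast
  have img: "(v(i := w)) ` insert i B = insert w (v ` B)"
    using iB by auto
  show ?case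
    by (rule exI[of _ "insert i B"], intro conjI exI[of _ "v(i := w)"], unfold img)
      (use B i w finB iB in \<open>auto simp: vec.dim_insert\<close>)
qed

lemma sum_eq_card_mult_bound:
  fixes f :: "'i \<Rightarrow> nat"
  assumes "finite A" "\<And>j. j \<in> A \<Longrightarrow> f j \<le> c" "card A * c \<le> sum f A" "j \<in> A"
  shows "f j = c"
proof (rule ccontr)
  assume "f j \<noteq> c"
  then have "f j < c" using assms(2,4) le_neq_implies_less by blast
  then have "sum f A < (\<Sum>_\<in>A. c)"
    using assms(1,2,4) by (intro sum_strict_mono_ex1) auto
  then show False using assms(3) by simp
qed

text \<open>For some threshold \<open>a\<close> at most \<open>r - a\<close> jumps exceed
  \<open>a\<close>. Bounding these by \<open>n\<close> and the others by \<open>a\<close>, and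
  comparing with the total \<open>m * r\<close>, leaves only two extreme distributions.\<close>

lemma jump_dichotomy:
  fixes W :: "('a::{finite,field}^'m^'n) set"
  assumes W: "mat.subspace W" and rk: "\<And>M. M \<in> W \<Longrightarrow> rank M \<le> r"
    and dimW: "mat.dim W = CARD('m) * r" and nm: "CARD('n) \<le> CARD('m)" and rn: "r \<le> CARD('n)"
    and x: "vec.span (x ` {..<CARD('m)}) = UNIV"
  shows "(\<forall>k<CARD('m). jump W x k = r) \<or>
    CARD('n) = CARD('m) \<and> 0 < r \<and> (\<forall>k<CARD('m). jump W x k \<in> {0, CARD('n)})"
proof -
  define m n where "m = CARD('m)" and "n = CARD('n)"
  define s where "s = jump W x"
  have sum: "(\<Sum>j<m. s j) = m * r"
    using sum_jump[OF W x] dimW by (simp add: m_def s_def)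
  have sn: "s j \<le> n" for j
    unfolding s_def n_def jump_def by (rule dim_subset_UNIV_cart_gen)
  \<comment> \<open>Otherwise there is an independent transversal of size \<open>Suc r\<close>, and
    with it a matrix in \<open>W\<close> of rank above \<open>r\<close>.\<close>
  have "\<exists>a\<le>r. card {j \<in> {..<m}. a < s j} \<le> r - a"
  proof (rule ccontr)
    assume "\<not> ?thesis"
    then have "Suc r - a \<le> card {j \<in> {..<m}. a < vec.dim ((\<lambda>M. M *v x j) ` vanishing W x j)}"
      if "a < Suc r" for a
      using that by (auto simp: s_def jump_def not_le Suc_diff_le less_Suc_eq_le Suc_le_eq dest: leD)
    from independent_transversal_exists[OF finite_lessThan this] obtain B v where
      B: "B \<subseteq> {..<m}" "card B = Suc r"
        "\<forall>j\<in>B. v j \<in> (\<lambda>M. M *v x j) ` vanishing W x j" "vec.dim (v ` B) = Suc r"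
      by blast
    obtain M where "M \<in> W" "card B \<le> rank M"
      using rank_ge_transversal[OF W finite_subset[OF B(1) finite_lessThan], of v x] B(2-4) by auto
    then show False using rk[of M] B(2) by simp
  qed
  then obtain a where a: "a \<le> r" and T: "card {j \<in> {..<m}. a < s j} \<le> r - a" by blast
  define T where "T = {j \<in> {..<m}. a < s j}"
  have Tm: "T \<subseteq> {..<m}" by (auto simp: T_def)
  have finT: "finite T" using Tm finite_subset by blast
  have tb: "card T \<le> r - a" using T by (simp add: T_def)
  have tm: "card T \<le> m" using card_mono[OF _ Tm] by simp
  have split: "(\<Sum>j<m. s j) = sum s T + sum s ({..<m} - T)"
    by (metis Tm finite_lessThan sum.subset_diff add.commute)
  have "sum s ({..<m} - T) \<le> (\<Sum>j\<in>{..<m} - T. a)"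
    by (rule sum_mono) (auto simp: T_def)
  also have "\<dots> = (m - card T) * a"
    using card_Diff_subset[OF finT Tm] by simp
  finally have s2: "sum s ({..<m} - T) \<le> (m - card T) * a" .
  have s1: "sum s T \<le> card T * n"
    using sum_mono[of T s "\<lambda>_. n"] sn by simp
  \<comment> \<open>Here \<open>b\<close> is \<open>r - a\<close> and \<open>d\<close> is
    \<open>n - a\<close>; sums replace truncated subtraction.\<close>
  obtain b where b: "r = a + b" using a le_iff_add by auto
  obtain d where d: "n = a + d" using a rn le_iff_add n_def by (metis le_trans)
  obtain e where e: "m = card T + e" using tm le_iff_add by blast
  have key: "m * b \<le> card T * d"
  proof -
    have "m * r \<le> card T * n + (m - card T) * a" using s1 s2 split sum by simp
    also have "\<dots> = card T * d + m * a" using e d by (simp add: algebra_simps)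
    finally show ?thesis using b by (simp add: algebra_simps)
  qed
  show ?thesis
  proof (cases "b = 0")
    case True
    then have "T = {}" using tb b finT by simp
    then have "s j \<le> r" if "j < m" for j
    proof -
      have "j \<notin> T" using \<open>T = {}\<close> by simp
      then show ?thesis using b True that by (simp add: T_def)
    qed
    then have "s j = r" if "j < m" for j
      using sum_eq_card_mult_bound[of "{..<m}" s r j] sum that by simp
    then show ?thesis by (simp add: s_def m_def)
  next
    case False
    \<comment> \<open>Since \<open>card T <= b\<close>, cancelling \<open>b\<close> gives
      \<open>m <= n - a\<close>, and \<open>n <= m\<close> leaves only \<open>a = 0\<close> and
      \<open>n = m\<close>.\<close>
    have "m * b \<le> b * d" using key tb b by (metis add_diff_cancel_left' le_trans mult_le_mono1)
    then have "m \<le> d" using False by (simp add: mult.commute)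
    then have eq: "d = m" "a = 0" "n = m" using d nm by (auto simp: m_def n_def)
    have "m > 0" by (simp add: m_def)
    then have "b \<le> card T" using key eq by (simp add: mult.commute)
    then have t: "card T = r" using tb b eq by simp
    have z: "s j = 0" if "j < m" "j \<notin> T" for j
      using that eq by (simp add: T_def)
    then have "sum s ({..<m} - T) = 0" by simp
    then have "card T * n \<le> sum s T" using split sum t eq by (simp add: mult.commute)
    then have "s j = n" if "j \<in> T" for j
      using sum_eq_card_mult_bound[of T s n j] finT sn that by blast
    with z have "s j \<in> {0, n}" if "j < m" for j
      using that by blast
    then show ?thesis using eq b False by (simp add: s_def m_def n_def)
  qed
qed

section \<open>Dimensions of evaluation images\<close>

text \<open>The given vectors stay at the front of the basis, so that the first jumps of the flag
  are taken at vectors of choice.\<close>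

lemma independent_list_extend:
  fixes xs :: "('a::field^'m) list"
  assumes "distinct xs" "vec.independent (set xs)"
  shows "\<exists>ys. length (xs @ ys) = CARD('m) \<and> vec.span ((!) (xs @ ys) ` {..<CARD('m)}) = UNIV"
proof -
  obtain B where B: "set xs \<subseteq> B" "vec.independent B" "UNIV \<subseteq> vec.span B"
    using vec.maximal_independent_subset_extend[of "set xs" UNIV] assms(2) by auto
  have finB: "finite B" using B(2) by (rule vec.finiteI_independent)
  obtain ys where ys: "set ys = B - set xs" "distinct ys"
    using finite_distinct_list[of "B - set xs"] finB by auto
  have "set (xs @ ys) = B" using ys B(1) by auto
  moreover have "distinct (xs @ ys)" using assms(1) ys by auto
  ultimately have len: "length (xs @ ys) = card B" by (metis distinct_card)
  also have "card B = CARD('m)"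
    using vec.basis_card_eq_dim[of B UNIV] B by (simp add: card_cart_basis)
  finally have "length (xs @ ys) = CARD('m)" .
  moreover from this have "(!) (xs @ ys) ` {..<CARD('m)} = set (xs @ ys)"
    by (metis atLeast0LessThan list.set_map map_nth set_upt)
  ultimately show ?thesis
    using B(3) \<open>set (xs @ ys) = B\<close> by (metis top.extremum_uniqueI)
qed

lemma jump_list_0: "jump W ((!) (a # l)) 0 = vec.dim ((\<lambda>M. M *v a) ` W)"
  by (simp add: jump_def vanishing_def)

lemma jump_list_1: "jump W ((!) (a # b # l)) (Suc 0) = vec.dim ((\<lambda>M. M *v b) ` {M \<in> W. M *v a = 0})"
  by (simp add: jump_def vanishing_def)

lemma colsp_subset_iff:
  assumes "vec.subspace J"
  shows "colsp M \<subseteq> J \<longleftrightarrow> (\<forall>j. column j M \<in> J)"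
proof -
  have "colsp M \<subseteq> J \<longleftrightarrow> columns M \<subseteq> J"
    unfolding colsp_def using assms vec.span_minimal vec.span_superset by blast
  then show ?thesis by (auto simp: columns_def)
qed

lemma rowsp_subset_iff:
  assumes "vec.subspace K"
  shows "rowsp M \<subseteq> K \<longleftrightarrow> (\<forall>i. M $ i \<in> K)"
proof -
  have "rowsp M \<subseteq> K \<longleftrightarrow> rows M \<subseteq> K"
    unfolding rowsp_def using assms vec.span_minimal vec.span_superset by blast
  then show ?thesis by (auto simp: rows_def row_def)
qed

lemma eval_image_constant:
  fixes W :: "('a::field^'m^'n) set"
  assumes W: "mat.subspace W" and m: "2 \<le> CARD('m)"
    and flags: "\<And>x k. vec.span (x ` {..<CARD('m)}) = UNIV \<Longrightarrow> k < CARD('m) \<Longrightarrow> jump W x k = r"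
  obtains J where "vec.subspace J" "vec.dim J = r" "\<And>M. M \<in> W \<Longrightarrow> colsp M \<subseteq> J"
proof -
  let ?E = "\<lambda>V x. (\<lambda>M. M *v x) ` V"
  have d1: "vec.dim (?E W x) = r" if x: "x \<noteq> 0" for x
  proof -
    obtain ys where "vec.span ((!) ([x] @ ys) ` {..<CARD('m)}) = UNIV"
      using independent_list_extend[of "[x]"] x by auto
    then show ?thesis
      using flags[of "(!) (x # ys)" 0] by (simp add: jump_list_0)
  qed
  \<comment> \<open>With \<open>d\<close> first and \<open>x\<close> second in the flag, the second
    jump measures the values at \<open>x\<close> of the matrices killing \<open>d\<close>.\<close>
  have d2: "vec.dim (?E {M \<in> W. M *v d = 0} x) = r" if "x \<noteq> 0" "d \<notin> vec.span {x}" for d x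
  proof -
    have "vec.independent {d, x}" "d \<noteq> x"
      using that vec.span_base[of x "{x}"] by (auto simp: vec.independent_insert)
    then obtain ys where "vec.span ((!) ([d, x] @ ys) ` {..<CARD('m)}) = UNIV"
      using independent_list_extend[of "[d, x]"] by auto
    then show ?thesis
      using flags[of "(!) (d # x # ys)" "Suc 0"] m by (simp add: jump_list_1)
  qed
  \<comment> \<open>Any non-zero vector would do; the index is arbitrary.\<close>
  define x0 :: "'a^'m" where "x0 = axis undefined 1"
  have x0: "x0 \<noteq> 0" by (simp add: x0_def)
  define J where "J = ?E W x0"
  have J: "vec.subspace J" unfolding J_def by (rule subspace_eval_image[OF W])
  have "M *v y \<in> J" if M: "M \<in> W" for M y
  proof (cases "y \<in> vec.span {x0}")
    case True
    then obtain c where "y = c *s x0" by (auto simp: vec.span_singleton)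
    then have "M *v y = c *s (M *v x0)" by (simp add: vec.scale)
    then show ?thesis using M J by (auto simp: J_def intro: vec.subspace_scale)
  next
    case False
    then have "y \<noteq> 0" using vec.span_zero by metis
    define D where "D = {M \<in> W. M *v (x0 - y) = 0}"
    have "x0 - y \<notin> vec.span {x0}"
      using False vec.span_diff[of x0 "{x0}" "x0 - y"] vec.span_base[of x0 "{x0}"] by auto
    then have D: "vec.dim (?E D x0) = r" unfolding D_def by (rule d2[OF x0])
    have subD: "mat.subspace D"
      using W by (auto simp: D_def mat.subspace_def matrix_vector_mult_add_rdistrib mscale_matrix_vector)
    \<comment> \<open>Matrices killing \<open>x0 - y\<close> take the same value at \<open>x0\<close> and at \<open>y\<close>.\<close>
    have eq: "?E D x0 = ?E D y"
      by (intro image_cong) (auto simp: D_def matrix_vector_mult_diff_distrib)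
    have "D \<subseteq> W" by (auto simp: D_def)
    \<comment> \<open>Restricting to \<open>D\<close> loses no values, neither at \<open>x0\<close>
      nor at \<open>y\<close>, because the dimension is \<open>r\<close> in all cases.\<close>
    have "?E D x0 = J"
      using D d1[OF x0] \<open>D \<subseteq> W\<close>
      by (intro vec.subspace_dim_equal[OF subspace_eval_image[OF subD] J]) (auto simp: J_def)
    moreover have "?E D y = ?E W y"
      using D d1[OF \<open>y \<noteq> 0\<close>] \<open>D \<subseteq> W\<close> eq
      by (intro vec.subspace_dim_equal[OF subspace_eval_image[OF subD] subspace_eval_image[OF W]]) auto
    ultimately show ?thesis using eq M by auto
  qed
  then have "colsp M \<subseteq> J" if "M \<in> W" for M
    using that by (simp add: colsp_subset_iff[OF J] column_eq_mult_axis)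
  then show ?thesis
    using that[of J] J d1[OF x0] by (simp add: J_def)
qed

text \<open>Double counting of the pairs \<open>(M, x)\<close> with \<open>M *v x = 0\<close>: each
  \<open>M\<close> contributes at least \<open>q ^ (CARD('m) - r)\<close>, each \<open>x\<close> in
  \<open>K\<close> contributes \<open>card W\<close>, and all other \<open>x\<close> together
  contribute less than \<open>card W\<close>.\<close>

lemma dim_common_kernel:
  fixes W :: "('a::{finite,field}^'m^'n) set"
  assumes W: "mat.subspace W" and rk: "\<And>M. M \<in> W \<Longrightarrow> rank M \<le> r"
    and nm: "CARD('n) = CARD('m)"
    and full: "\<And>x. x \<noteq> 0 \<Longrightarrow> vec.dim ((\<lambda>M. M *v x) ` W) \<in> {0, CARD('n)}"
  shows "CARD('m) - r \<le> vec.dim {x. \<forall>M\<in>W. M *v x = 0}"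
proof -
  define q where "q = CARD('a)"
  define K where "K = {x. \<forall>M\<in>W. M *v x = 0}"
  have q: "1 < q" unfolding q_def by (rule CARD_field_gt_1)
  have W0: "0 < card W" using mat.subspace_0[OF W] by (auto simp: card_gt_0_iff)
  have K: "vec.subspace K"
    by (auto simp: K_def vec.subspace_def matrix_vector_right_distrib vec.scale)
  have cardK: "card K = q ^ vec.dim K"
    using vec.card_subspace[OF _ _ K] by (simp add: q_def)
  have in_K: "card {M \<in> W. M *v x = 0} = card W" if "x \<in> K" for x
  proof -
    have "{M \<in> W. M *v x = 0} = W" using that by (auto simp: K_def)
    then show ?thesis by simp
  qed
  \<comment> \<open>By \<open>full\<close>, evaluation at such an \<open>x\<close> is onto, so all
    its fibres in \<open>W\<close> have size \<open>card W / q ^ CARD('m)\<close>.\<close>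
  have not_in_K: "card {M \<in> W. M *v x = 0} * q ^ CARD('m) = card W" if "x \<notin> K" for x
  proof -
    have "x \<noteq> 0" using that by (auto simp: K_def)
    moreover have "vec.dim ((\<lambda>M. M *v x) ` W) \<noteq> 0"
      using that by (auto simp: K_def)
    ultimately have "vec.dim ((\<lambda>M. M *v x) ` W) = CARD('m)"
      using full[of x] nm by auto
    then have "card ((\<lambda>M. M *v x) ` W) = q ^ CARD('m)"
      using vec.card_subspace[OF _ _ subspace_eval_image[OF W], of x] by (simp add: q_def)
    then show ?thesis
      using linear.card_kernel_image[OF linear_matrix_eval W, of x] by simp
  qed
  have ker: "q ^ (CARD('m) - r) \<le> card {x. M *v x = 0}" if "M \<in> W" for M
  proof -
    have "vec.subspace {x. M *v x = 0}"
      by (auto simp: vec.subspace_def matrix_vector_right_distrib vec.scale)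
    then have "card {x. M *v x = 0} = q ^ vec.dim {x. M *v x = 0}"
      using vec.card_subspace[of "{x. M *v x = 0}"] by (simp add: q_def)
    moreover have "CARD('m) - r \<le> vec.dim {x. M *v x = 0}"
      using rank_nullity[of M] rk[OF that] by simp
    ultimately show ?thesis using q by simp
  qed
  let ?R = "\<Sum>x\<in>- K. card {M \<in> W. M *v x = 0}"
  have "card W * q ^ (CARD('m) - r) \<le> (\<Sum>M\<in>W. card {x. M *v x = 0})"
    using sum_mono[of W "\<lambda>_. q ^ (CARD('m) - r)"] ker by simp
  also have "\<dots> = (\<Sum>x\<in>UNIV. card {M \<in> W. M *v x = 0})"
    using sum_multicount_gen[of W "UNIV :: ('a^'m) set" "\<lambda>M x. M *v x = 0"] by simp
  also have "\<dots> = (\<Sum>x\<in>K. card {M \<in> W. M *v x = 0}) + ?R"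
    using sum.subset_diff[of K UNIV "\<lambda>x. card {M \<in> W. M *v x = 0}"]
    by (simp add: Compl_eq_Diff_UNIV)
  also have "\<dots> = card K * card W + ?R"
    by (simp add: in_K)
  finally have count: "card W * q ^ (CARD('m) - r) \<le> card K * card W + ?R" .
  \<comment> \<open>As \<open>0\<close> lies in \<open>K\<close>, fewer than
    \<open>q ^ CARD('m)\<close> vectors lie outside. The strict bound on \<open>?R\<close> costs
    only the summand 1 in \<open>Suc (card K)\<close>, which integrality removes.\<close>
  have "?R * q ^ CARD('m) = card (- K) * card W"
    by (simp add: sum_distrib_right not_in_K)
  also have "\<dots> < q ^ CARD('m) * card W"
  proof -
    have "0 \<in> K" by (simp add: K_def)
    then have "card (- K) < card (UNIV :: ('a^'m) set)"
      by (intro psubset_card_mono) auto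
    then show ?thesis
      using W0 by (simp add: q_def)
  qed
  finally have "?R < card W" by (simp add: mult.commute)
  with count have "card W * q ^ (CARD('m) - r) < card W * Suc (card K)"
    by (simp add: mult.commute)
  then have "q ^ (CARD('m) - r) < Suc (card K)"
    by (rule mult_less_cancel1[THEN iffD1, THEN conjunct2])
  then have "q ^ (CARD('m) - r) \<le> q ^ vec.dim K"
    by (simp add: cardK)
  then show ?thesis
    using q by (simp add: K_def)
qed

text \<open>Each flag satisfies one alternative, but which one could vary. If \<open>x\<close> and
  \<open>y\<close> disagree, the flags starting with \<open>x\<close>, \<open>y\<close> and with
  \<open>y\<close>, \<open>x\<close> share the jump at a third vector, which is impossible. For
  \<open>CARD('m) = 2\<close> there is no third vector, and a direct argument on matrices of rank at
  most 1 is used.\<close>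

lemma eval_image_dichotomy:
  fixes W :: "('a::{finite,field}^'m^'n) set"
  assumes W: "mat.subspace W" and rk: "\<And>M. M \<in> W \<Longrightarrow> rank M \<le> r"
    and dimW: "mat.dim W = CARD('m) * r" and nm: "CARD('n) = CARD('m)" and r0: "0 < r" and rn: "r < CARD('n)"
  shows "(\<forall>x. x \<noteq> 0 \<longrightarrow> vec.dim ((\<lambda>M. M *v x) ` W) = r) \<or>
    (\<forall>x. x \<noteq> 0 \<longrightarrow> vec.dim ((\<lambda>M. M *v x) ` W) \<in> {0, CARD('n)})"
proof (rule ccontr)
  let ?E = "\<lambda>V x. (\<lambda>M. M *v x) ` V"
  assume "\<not> ?thesis"
  then obtain x y where x: "x \<noteq> 0" "vec.dim (?E W x) \<notin> {0, CARD('n)}"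
    and y: "y \<noteq> 0" "vec.dim (?E W y) \<noteq> r" by blast
  have dich: "(\<forall>k<CARD('m). jump W z k = r) \<or> (\<forall>k<CARD('m). jump W z k \<in> {0, CARD('n)})"
    if "vec.span (z ` {..<CARD('m)}) = UNIV" for z
    using jump_dichotomy[OF W rk dimW _ _ that] nm rn by auto
  have dx: "vec.dim (?E W x) = r"
  proof -
    obtain ys where "vec.span ((!) ([x] @ ys) ` {..<CARD('m)}) = UNIV"
      using independent_list_extend[of "[x]"] x(1) by auto
    from dich[OF this] have "jump W ((!) (x # ys)) 0 = r \<or> jump W ((!) (x # ys)) 0 \<in> {0, CARD('n)}"
      using zero_less_card_finite by fastforce
    then show ?thesis
      using x(2) unfolding jump_list_0 by blast
  qed
  \<comment> \<open>Proportional non-zero vectors have value spaces of equal dimension.\<close>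
  have yx: "y \<notin> vec.span {x}"
  proof
    assume "y \<in> vec.span {x}"
    then obtain c where c: "y = c *s x" by (auto simp: vec.span_singleton)
    then have "c \<noteq> 0" using y(1) by auto
    have "?E W y = (\<lambda>v. c *s v) ` ?E W x"
      by (simp add: c vec.scale image_image)
    also have "vec.dim \<dots> = vec.dim (?E W x)"
      using \<open>c \<noteq> 0\<close> by (intro vec.dim_image_eq) (auto intro!: vec.linear_scale_self simp: inj_on_def)
    finally show False using dx y(2) by simp
  qed
  have "vec.independent {x, y}" "x \<noteq> y"
    using yx x(1) y(1) vec.span_base[of x "{x}"] by (auto simp: vec.independent_insert insert_commute[of x y])
  then obtain ys where ys: "length ([x, y] @ ys) = CARD('m)"
    "vec.span ((!) ([x, y] @ ys) ` {..<CARD('m)}) = UNIV"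
    using independent_list_extend[of "[x, y]"] by auto
  have "(!) (x # y # ys) ` {..<CARD('m)} = (!) (y # x # ys) ` {..<CARD('m)}"
  proof -
    have "(!) l ` {..<CARD('m)} = set l" if "length l = CARD('m)" for l :: "('a^'m) list"
      by (metis that atLeast0LessThan list.set_map map_nth set_upt)
    then show ?thesis using ys(1) by (simp add: insert_commute)
  qed
  then have ys': "vec.span ((!) (y # x # ys) ` {..<CARD('m)}) = UNIV"
    using ys(2) by simp
  have jx: "jump W ((!) (x # y # ys)) k = r" if "k < CARD('m)" for k
  proof -
    have "jump W ((!) (x # y # ys)) 0 \<notin> {0, CARD('n)}" using x(2) unfolding jump_list_0 .
    then show ?thesis using dich[OF ys(2)] that zero_less_card_finite by fastforce
  qed
  have jy: "jump W ((!) (y # x # ys)) k \<in> {0, CARD('n)}" if "k < CARD('m)" for k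
  proof -
    have "jump W ((!) (y # x # ys)) 0 \<noteq> r" using y(2) unfolding jump_list_0 .
    then show ?thesis using dich[OF ys'] that zero_less_card_finite by blast
  qed
  have m2: "2 \<le> CARD('m)" using ys(1) by simp
  show False
  proof (cases "CARD('m) = 2")
    case False
    have "vanishing W ((!) (x # y # ys)) 2 = vanishing W ((!) (y # x # ys)) 2"
      by (auto simp: vanishing_def numeral_2_eq_2 less_Suc_eq)
    then have "jump W ((!) (x # y # ys)) 2 = jump W ((!) (y # x # ys)) 2"
      by (simp add: jump_def numeral_2_eq_2)
    then show False using jx[of 2] jy[of 2] False m2 r0 rn by simp
  next
    case True
    \<comment> \<open>Take \<open>N\<close> in \<open>W\<close> killing \<open>x\<close> but not
      \<open>y\<close>, and \<open>M\<close> in \<open>W\<close> with \<open>w = M *v y\<close>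
      independent of \<open>N *v y\<close>. Then \<open>M *v x\<close> is non-zero, and
      \<open>M\<close> and \<open>M + N\<close> agree at \<open>x\<close>. Both have rank at most 1,
      so \<open>w\<close> and \<open>w + N *v y\<close> lie on the line of \<open>M *v x\<close>,
      and so does \<open>N *v y\<close>, a contradiction.\<close>
    then have r1: "r = 1" using r0 rn nm by simp
    have e: "vec.dim (?E {M \<in> W. M *v x = 0} y) = 1"
      using jx[of "Suc 0"] True r1 by (simp add: jump_list_1)
    have "vec.dim (?E {M \<in> W. M *v x = 0} y) \<le> vec.dim (?E W y)"
      by (intro vec.dim_subset) auto
    then have "vec.dim (?E W y) = 2"
      using e jy[of 0] True nm by (simp add: jump_list_0 del: vec.dim_eq_0)
    then have surj: "?E W y = UNIV"
      using vec.subspace_dim_equal[OF subspace_eval_image[OF W] vec.subspace_UNIV, of y] nm True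
      by (simp add: card_cart_basis)
    obtain N where N: "N \<in> W" "N *v x = 0" "N *v y \<noteq> 0"
    proof -
      have "\<not> ?E {M \<in> W. M *v x = 0} y \<subseteq> {0}"
        using e vec.dim_eq_0[of "?E {M \<in> W. M *v x = 0} y"] by (simp del: vec.dim_eq_0)
      then show ?thesis using that by blast
    qed
    have "vec.dim {N *v y} < vec.dim (UNIV :: ('a^'n) set)"
      using N nm True by (simp add: card_cart_basis)
    then have "vec.span {N *v y} \<noteq> UNIV" by (metis less_irrefl vec.dim_span)
    then obtain w where w: "w \<notin> vec.span {N *v y}" by blast
    obtain M where M: "M \<in> W" "M *v y = w" using surj by (metis UNIV_I imageE)
    have "M *v x \<noteq> 0"
    proof
      assume "M *v x = 0"
      then have "{w, N *v y} \<subseteq> ?E {M \<in> W. M *v x = 0} y" using M N by auto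
      from vec.dim_subset[OF this] have "vec.dim {w, N *v y} \<le> 1" using e by simp
      then show False using w N(3) by (simp add: vec.dim_insert)
    qed
    have dep: "P *v y \<in> vec.span {P *v x}" if "P \<in> W" "P *v x \<noteq> 0" for P
    proof (rule ccontr)
      assume "P *v y \<notin> vec.span {P *v x}"
      then have "2 = vec.dim {P *v y, P *v x}" using that by (simp add: vec.dim_insert)
      also have "\<dots> \<le> rank P" unfolding rank_eq_dim_range by (rule vec.dim_subset) auto
      finally show False using rk[OF that(1)] r1 by simp
    qed
    have "(M + N) *v x = M *v x" using N by (simp add: matrix_vector_mult_add_rdistrib)
    then have "w + N *v y \<in> vec.span {M *v x}" "w \<in> vec.span {M *v x}"
      using dep[of M] dep[of "M + N"] M N(1) mat.subspace_add[OF W M(1) N(1)] \<open>M *v x \<noteq> 0\<close>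
      by (auto simp: matrix_vector_mult_add_rdistrib)
    moreover from vec.span_diff[OF this] have "N *v y \<in> vec.span {M *v x}" by simp
    ultimately have "vec.dim {w, N *v y} \<le> vec.dim {M *v x}"
      by (intro vec.dim_mono) auto
    then show False using w N(3) by (simp add: vec.dim_insert split: if_splits)
  qed
qed

section \<open>Optimal anticodes and generalized weights\<close>

lemma mem_subcode_c_UNIV: "vec.subspace J \<Longrightarrow> M \<in> subcode_c UNIV J \<longleftrightarrow> (\<forall>j. column j M \<in> J)"
  by (simp add: subcode_c_def colsp_subset_iff)

lemma mem_subcode_r_UNIV: "vec.subspace K \<Longrightarrow> M \<in> subcode_r UNIV K \<longleftrightarrow> (\<forall>i. M $ i \<in> K)"
  by (simp add: subcode_r_def rowsp_subset_iff)

lemma subspace_subcode_c_UNIV: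
  fixes J :: "('a::field^'n) set"
  assumes J: "vec.subspace J"
  shows "mat.subspace (subcode_c UNIV J :: ('a^'m^'n) set)"
proof -
  have "column j (mscale c M) = c *s column j M" for c j and M :: "'a^'m^'n"
    by (simp add: column_def mscale_def vec_eq_iff)
  moreover have "column j (M + N) = column j M + column j N" for j and M N :: "'a^'m^'n"
    by (simp add: column_def vec_eq_iff)
  moreover have "column j (0 :: 'a^'m^'n) = 0" for j
    by (simp add: column_def vec_eq_iff)
  ultimately show ?thesis
    using J by (simp add: mat.subspace_def mem_subcode_c_UNIV vec.subspace_0 vec.subspace_add vec.subspace_scale)
qed

lemma subspace_subcode_r_UNIV:
  fixes K :: "('a::field^'m) set"
  assumes K: "vec.subspace K"
  shows "mat.subspace (subcode_r UNIV K :: ('a^'m^'n) set)"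
proof -
  have "mscale c M $ i = c *s (M $ i)" for c i and M :: "'a^'m^'n"
    by (simp add: mscale_def vec_eq_iff)
  then show ?thesis
    using K by (simp add: mat.subspace_def mem_subcode_r_UNIV vec.subspace_0 vec.subspace_add vec.subspace_scale)
qed

text \<open>Such a matrix is a free choice of a vector of \<open>K\<close> for each row.\<close>

lemma card_subcode_r_UNIV:
  fixes K :: "('a::{finite,field}^'m) set"
  assumes K: "vec.subspace K"
  shows "card (subcode_r UNIV K :: ('a^'m^'n) set) = card K ^ CARD('n)"
proof -
  have "bij_betw vec_nth (subcode_r UNIV K :: ('a^'m^'n) set) (PiE UNIV (\<lambda>_. K))"
    by (rule bij_betw_byWitness[where f' = "\<lambda>g. \<chi> i. g i"])
      (auto simp: mem_subcode_r_UNIV[OF K] fun_eq_iff PiE_def Pi_def)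
  then have "card (subcode_r UNIV K :: ('a^'m^'n) set) = card (PiE (UNIV :: 'n set) (\<lambda>_. K))"
    by (rule bij_betw_same_card)
  then show ?thesis by (simp add: card_PiE)
qed

lemma card_subcode_c_UNIV:
  fixes J :: "('a::{finite,field}^'n) set"
  assumes J: "vec.subspace J"
  shows "card (subcode_c UNIV J :: ('a^'m^'n) set) = card J ^ CARD('m)"
proof -
  have "bij_betw transpose (subcode_c UNIV J :: ('a^'m^'n) set) (subcode_r UNIV J)"
    by (rule bij_betw_byWitness[where f' = transpose])
      (auto simp: mem_subcode_r_UNIV[OF J] mem_subcode_c_UNIV[OF J] transpose_def column_def)
  then show ?thesis
    using bij_betw_same_card card_subcode_r_UNIV[OF J] by metis
qed

lemma dim_subcode_c_UNIV:
  fixes J :: "('a::{finite,field}^'n) set"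
  assumes J: "vec.subspace J"
  shows "mat.dim (subcode_c UNIV J :: ('a^'m^'n) set) = CARD('m) * vec.dim J"
proof -
  have "CARD('a) ^ mat.dim (subcode_c UNIV J :: ('a^'m^'n) set) = CARD('a) ^ (CARD('m) * vec.dim J)"
    using mat.card_subspace[OF _ _ subspace_subcode_c_UNIV[OF J, where 'm = 'm]] card_subcode_c_UNIV[OF J, where 'm = 'm]
      vec.card_subspace[OF _ _ J] by (simp flip: power_mult add: mult.commute)
  then show ?thesis using CARD_field_gt_1 power_inject_exp by blast
qed

lemma dim_subcode_r_UNIV:
  fixes K :: "('a::{finite,field}^'m) set"
  assumes K: "vec.subspace K"
  shows "mat.dim (subcode_r UNIV K :: ('a^'m^'n) set) = CARD('n) * vec.dim K"
proof -
  have "CARD('a) ^ mat.dim (subcode_r UNIV K :: ('a^'m^'n) set) = CARD('a) ^ (CARD('n) * vec.dim K)"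
    using mat.card_subspace[OF _ _ subspace_subcode_r_UNIV[OF K, where 'n = 'n]] card_subcode_r_UNIV[OF K, where 'n = 'n]
      vec.card_subspace[OF _ _ K] by (simp flip: power_mult add: mult.commute)
  then show ?thesis using CARD_field_gt_1 power_inject_exp by blast
qed

text \<open>The rank \<open>vec.dim J\<close> is attained because \<open>CARD('m)\<close> columns
  suffice to span \<open>J\<close>.\<close>

lemma optimal_anticode_subcode_c:
  fixes J :: "('a::{finite,field}^'n) set"
  assumes J: "vec.subspace J" and nm: "CARD('n) \<le> CARD('m)"
  shows "optimal_anticode (subcode_c UNIV J :: ('a^'m^'n) set)"
proof -
  have "maxrk (subcode_c UNIV J :: ('a^'m^'n) set) = vec.dim J"
    unfolding maxrk_def
  proof (rule Max_eqI)
    fix s assume "s \<in> rank ` (subcode_c UNIV J :: ('a^'m^'n) set)"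
    then obtain M :: "'a^'m^'n" where "M \<in> subcode_c UNIV J" "s = rank M" by blast
    then show "s \<le> vec.dim J"
      by (auto simp: rank_eq_dim_columns mem_subcode_c_UNIV[OF J] columns_def intro!: vec.dim_subset)
  next
    have "vec.dim J \<le> CARD('m)" using dim_subset_UNIV_cart_gen[of J] nm by simp
    then obtain g :: "'m \<Rightarrow> 'a^'n" where g: "vec.span (range g) = J"
      using subspace_span_range[OF J] by blast
    define M :: "'a^'m^'n" where "M = (\<chi> i j. g j $ i)"
    have col: "column j M = g j" for j by (simp add: M_def column_def)
    then have "columns M = range g" by (auto simp: columns_def)
    then have "rank M = vec.dim J" by (metis g rank_eq_dim_columns vec.dim_span)
    moreover have "M \<in> subcode_c UNIV J"
      using g vec.span_superset[of "range g"] by (auto simp: mem_subcode_c_UNIV[OF J] col)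
    ultimately show "vec.dim J \<in> rank ` (subcode_c UNIV J :: ('a^'m^'n) set)"
      by (metis image_eqI)
  qed simp
  then show ?thesis
    by (simp add: optimal_anticode_def subspace_subcode_c_UNIV[OF J] dim_subcode_c_UNIV[OF J])
qed

text \<open>Squareness makes the dimension \<open>CARD('n) * vec.dim K\<close> equal to
  \<open>CARD('m)\<close> times the maximal rank.\<close>

lemma optimal_anticode_subcode_r:
  fixes K :: "('a::{finite,field}^'m) set"
  assumes K: "vec.subspace K" and nm: "CARD('n) = CARD('m)"
  shows "optimal_anticode (subcode_r UNIV K :: ('a^'m^'n) set)"
proof -
  have "maxrk (subcode_r UNIV K :: ('a^'m^'n) set) = vec.dim K"
    unfolding maxrk_def
  proof (rule Max_eqI)
    fix s assume "s \<in> rank ` (subcode_r UNIV K :: ('a^'m^'n) set)"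
    then obtain M :: "'a^'m^'n" where "M \<in> subcode_r UNIV K" "s = rank M" by blast
    then show "s \<le> vec.dim K"
      by (auto simp: row_rank_def_gen mem_subcode_r_UNIV[OF K] rows_def row_def intro!: vec.dim_subset)
  next
    have "vec.dim K \<le> CARD('n)" using dim_subset_UNIV_cart_gen[of K] nm by simp
    then obtain g :: "'n \<Rightarrow> 'a^'m" where g: "vec.span (range g) = K"
      using subspace_span_range[OF K] by blast
    define M :: "'a^'m^'n" where "M = (\<chi> i. g i)"
    have row: "M $ i = g i" for i by (simp add: M_def)
    then have "rows M = range g" by (auto simp: rows_def row_def)
    then have "rank M = vec.dim K" by (metis g row_rank_def_gen vec.dim_span)
    moreover have "M \<in> subcode_r UNIV K"
      using g vec.span_superset[of "range g"] by (auto simp: mem_subcode_r_UNIV[OF K] row)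
    ultimately show "vec.dim K \<in> rank ` (subcode_r UNIV K :: ('a^'m^'n) set)"
      by (metis image_eqI)
  qed simp
  then show ?thesis
    using nm by (simp add: optimal_anticode_def subspace_subcode_r_UNIV[OF K] dim_subcode_r_UNIV[OF K])
qed

lemma mat_subspace_dim_equal:
  fixes U V :: "('a::{finite,field}^'m^'n) set"
  assumes "mat.subspace U" "mat.subspace V" "U \<subseteq> V" "mat.dim V \<le> mat.dim U"
  shows "U = V"
proof (rule card_seteq[OF _ assms(3)])
  show "card V \<le> card U"
    using mat.card_subspace[OF _ _ assms(1)] mat.card_subspace[OF _ _ assms(2)] assms(4)
      CARD_field_gt_1[where 'a = 'a] by simp
qed simp

text \<open>In every case \<open>A\<close> is contained in a subcode of column or row type whose
  dimension does not exceed that of \<open>A\<close>, hence equals it.\<close>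

theorem optimal_anticode_classification:
  fixes A :: "('a::{finite,field}^'m^'n) set"
  assumes A: "optimal_anticode A" and n2: "2 \<le> CARD('n)" and nm: "CARD('n) \<le> CARD('m)"
  shows "(\<exists>J. vec.subspace J \<and> A = subcode_c UNIV J) \<or>
    CARD('n) = CARD('m) \<and> (\<exists>K. vec.subspace K \<and> A = subcode_r UNIV K)"
proof -
  define r where "r = maxrk A"
  have W: "mat.subspace A" and dimA: "mat.dim A = CARD('m) * r"
    using A by (auto simp: optimal_anticode_def r_def)
  have rk: "rank M \<le> r" if "M \<in> A" for M
    using that by (simp add: r_def maxrk_def)
  have "r \<in> rank ` A"
    unfolding r_def maxrk_def using mat.subspace_0[OF W] by (intro Max_in) auto
  then have rn: "r \<le> CARD('n)"
    using dim_subset_UNIV_cart_gen by (auto simp: rank_eq_dim_columns)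
  have by_J: ?thesis if J: "vec.subspace J" "vec.dim J = r" "\<And>M. M \<in> A \<Longrightarrow> colsp M \<subseteq> J" for J
  proof -
    have "A \<subseteq> subcode_c UNIV J" using J(3) by (auto simp: subcode_c_def)
    then have "A = subcode_c UNIV J"
      by (intro mat_subspace_dim_equal[OF W subspace_subcode_c_UNIV[OF J(1)]])
        (simp_all add: dim_subcode_c_UNIV[OF J(1)] dimA J(2))
    then show ?thesis using J(1) by blast
  qed
  have by_flags: ?thesis
    if flags: "\<And>x k. vec.span (x ` {..<CARD('m)}) = UNIV \<Longrightarrow> k < CARD('m) \<Longrightarrow> jump A x k = r"
  proof (rule eval_image_constant[OF W _ flags])
    show "2 \<le> CARD('m)" using n2 nm by simp
    show ?thesis if "vec.subspace J" "vec.dim J = r" "\<And>M. M \<in> A \<Longrightarrow> colsp M \<subseteq> J" for J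
      using that by (rule by_J)
  qed
  have dich: "(\<forall>k<CARD('m). jump A x k = r) \<or>
      CARD('n) = CARD('m) \<and> 0 < r \<and> (\<forall>k<CARD('m). jump A x k \<in> {0, CARD('n)})"
    if "vec.span (x ` {..<CARD('m)}) = UNIV" for x
    by (rule jump_dichotomy[OF W rk dimA nm rn that])
  \<comment> \<open>The first case rules out the second alternative of \<open>dich\<close>; in the
    second, \<open>A\<close> is the whole space; only the third needs
    \<open>eval_image_dichotomy\<close>.\<close>
  consider "CARD('n) \<noteq> CARD('m) \<or> r = 0" | "r = CARD('n)"
    | "CARD('n) = CARD('m)" "0 < r" "r < CARD('n)"
    using rn le_neq_implies_less by blast
  then show ?thesis
  proof cases
    case 1
    show ?thesis
    proof (rule by_flags)
      show "jump A x k = r"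
        if x: "vec.span (x ` {..<CARD('m)}) = UNIV" and k: "k < CARD('m)" for x :: "nat \<Rightarrow> 'a^'m" and k
        using dich[OF x] 1 k by auto
    qed
  next
    case 2
    then show ?thesis
      by (intro by_J[of UNIV]) (simp_all add: card_cart_basis)
  next
    case 3
    from eval_image_dichotomy[OF W rk dimA 3] show ?thesis
    proof
      assume all: "\<forall>x. x \<noteq> 0 \<longrightarrow> vec.dim ((\<lambda>M. M *v x) ` A) = r"
      show ?thesis
      proof (rule by_flags)
        fix x :: "nat \<Rightarrow> 'a^'m" and k
        assume x: "vec.span (x ` {..<CARD('m)}) = UNIV" and k: "k < CARD('m)"
        \<comment> \<open>As many spanning vectors as the dimension are distinct and independent, so
          \<open>x 0\<close> is non-zero. Its jump \<open>r\<close> is neither \<open>0\<close> nor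
          \<open>CARD('n)\<close>, which selects the first alternative for this flag.\<close>
        have "CARD('m) \<le> card (x ` {..<CARD('m)})"
          using vec.dim_le_card[of UNIV "x ` {..<CARD('m)}"] x by (simp add: card_cart_basis)
        then have "inj_on x {..<CARD('m)}"
          by (metis card_image_le card_lessThan eq_card_imp_inj_on finite_lessThan le_antisym)
        moreover have "vec.independent (x ` {..<CARD('m)})"
          using vec.card_eq_dim[of "x ` {..<CARD('m)}" UNIV] x calculation
          by (simp add: card_image card_cart_basis)
        ultimately have "x 0 \<noteq> 0"
          using k by (metis imageI lessThan_iff vec.dependent_zero zero_less_card_finite)
        then have "jump A x 0 = r"
          using all by (simp add: jump_def vanishing_def)
        then show "jump A x k = r"
          using dich[OF x] 3 k zero_less_card_finite[where 'a = 'm]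
          by (metis empty_iff insert_iff less_irrefl)
      qed
    next
      assume full: "\<forall>x. x \<noteq> 0 \<longrightarrow> vec.dim ((\<lambda>M. M *v x) ` A) \<in> {0, CARD('n)}"
      define Z where "Z = {x. \<forall>M\<in>A. M *v x = 0}"
      have Z: "vec.subspace Z"
        by (auto simp: Z_def vec.subspace_def matrix_vector_right_distrib vec.scale)
      have "CARD('m) - r \<le> vec.dim Z"
        unfolding Z_def using dim_common_kernel[OF W rk 3(1)] full by blast
      \<comment> \<open>A large common kernel has a small complement, and that complement contains
        all rows of all matrices in \<open>A\<close>.\<close>
      then have dimK: "vec.dim (orth Z) \<le> r" using dim_orth[OF Z] by simp
      have K: "vec.subspace (orth Z)" by (rule subspace_orth)
      have "A \<subseteq> subcode_r UNIV (orth Z)"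
      proof
        fix M assume M: "M \<in> A"
        have "M $ i \<in> orth Z" for i
        proof -
          have "x \<in> orth (rows M)" if "x \<in> Z" for x
            using that M by (auto simp: Z_def simp flip: matrix_vector_mult_eq_0_iff)
          moreover have "M $ i \<in> rows M" by (auto simp: rows_def row_def)
          ultimately show ?thesis by (auto simp: orth_def dotp_commute)
        qed
        then show "M \<in> subcode_r UNIV (orth Z)" by (simp add: mem_subcode_r_UNIV[OF K])
      qed
      then have "A = subcode_r UNIV (orth Z)"
        by (intro mat_subspace_dim_equal[OF W subspace_subcode_r_UNIV[OF K]])
          (simp_all add: dim_subcode_r_UNIV[OF K] dimA 3(1) dimK)
      then show ?thesis using K 3(1) by blast
    qed
  qed
qed

section \<open>Generalized weights as minimal dimensions\<close>

text \<open>\<open>orth\<close> is an involution on subspaces exchanging dimension and codimension,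
  so substituting \<open>orth J\<close> for \<open>J\<close> removes both the complement and the
  subtraction.\<close>

lemma codim_orth_set:
  fixes P :: "('a::{finite,field}^'k) set \<Rightarrow> bool"
  shows "{CARD('k) - vec.dim J | J. vec.subspace J \<and> P (orth J)} = {vec.dim J | J. vec.subspace J \<and> P J}"
proof -
  have codim: "CARD('k) - vec.dim J = vec.dim (orth J)" if "vec.subspace J" for J :: "('a^'k) set"
    using dim_orth[OF that] by simp
  show ?thesis
  proof (intro subset_antisym subsetI)
    fix d assume "d \<in> {CARD('k) - vec.dim J | J. vec.subspace J \<and> P (orth J)}"
    then show "d \<in> {vec.dim J | J. vec.subspace J \<and> P J}"
      using codim subspace_orth by auto
  next
    fix d assume "d \<in> {vec.dim J | J. vec.subspace J \<and> P J}"
    then obtain J where "vec.subspace J" "P J" "d = vec.dim J" by blast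
    then have "d = CARD('k) - vec.dim (orth J) \<and> vec.subspace (orth J) \<and> P (orth (orth J))"
      by (simp add: codim orth_orth subspace_orth)
    then show "d \<in> {CARD('k) - vec.dim J | J. vec.subspace J \<and> P (orth J)}" by blast
  qed
qed

lemma gen_weight_c_eq:
  fixes C :: "('a::{finite,field}^'m^'n) set"
  shows "gen_weight_c C i = real (Min {vec.dim J | J. vec.subspace J \<and> i \<le> mat.dim (subcode_c C J)})"
proof -
  have "real (mat.dim C) - real CARD('m) * rho_c C J \<ge> real i \<longleftrightarrow> i \<le> mat.dim (subcode_c C (orth J))" for J
    by (simp add: rho_c_def)
  then show ?thesis
    unfolding gen_weight_c_def
    using codim_orth_set[of "\<lambda>J. i \<le> mat.dim (subcode_c C J)"] by simp
qed

lemma gen_weight_r_eq: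
  fixes C :: "('a::{finite,field}^'m^'n) set"
  shows "gen_weight_r C i = real (Min {vec.dim K | K. vec.subspace K \<and> i \<le> mat.dim (subcode_r C K)})"
proof -
  have "real (mat.dim C) - real CARD('n) * rho_r C K \<ge> real i \<longleftrightarrow> i \<le> mat.dim (subcode_r C (orth K))" for K
    by (simp add: rho_r_def)
  then show ?thesis
    unfolding gen_weight_r_def
    using codim_orth_set[of "\<lambda>K. i \<le> mat.dim (subcode_r C K)"] by simp
qed

lemma dims_finite_nonempty:
  fixes P :: "('a::field^'k) set \<Rightarrow> bool"
  assumes "P UNIV"
  shows "finite {vec.dim J | J. vec.subspace J \<and> P J}" "{vec.dim J | J. vec.subspace J \<and> P J} \<noteq> {}"
proof -
  show "finite {vec.dim J | J. vec.subspace J \<and> P J}"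
    by (rule finite_subset[of _ "{..CARD('k)}"]) (auto simp: dim_subset_UNIV_cart_gen)
  show "{vec.dim J | J. vec.subspace J \<and> P J} \<noteq> {}"
    using assms vec.subspace_UNIV by blast
qed

theorem theorem6p1:
  fixes C :: "('a::{finite,field}^'m^'n) set" and i :: nat
  assumes "2 \<le> CARD('n)" and "CARD('n) \<le> CARD('m)"
    and "mat.subspace C" and "C \<noteq> {0}"
    and "1 \<le> i" and "i \<le> mat.dim C"
  shows "(CARD('m) > CARD('n) \<longrightarrow> gen_weight C i = gen_weight_c C i)
       \<and> (CARD('m) = CARD('n) \<longrightarrow> gen_weight C i = min (gen_weight_c C i) (gen_weight_r C i))"
proof -
  define G where "G = {mat.dim A | A. optimal_anticode A \<and> mat.dim (C \<inter> A) \<ge> i}"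
  define Dc where "Dc = {vec.dim J | J. vec.subspace J \<and> i \<le> mat.dim (subcode_c C J)}"
  define Dr where "Dr = {vec.dim K | K. vec.subspace K \<and> i \<le> mat.dim (subcode_r C K)}"
  have "subcode_c C UNIV = C" "subcode_r C UNIV = C"
    by (auto simp: subcode_c_def subcode_r_def)
  then have D: "finite Dc" "Dc \<noteq> {}" "finite Dr" "Dr \<noteq> {}"
    unfolding Dc_def Dr_def using assms(6) by (intro dims_finite_nonempty; simp)+
  have cap: "C \<inter> subcode_c UNIV J = subcode_c C J" "C \<inter> subcode_r UNIV K = subcode_r C K" for J K
    by (auto simp: subcode_c_def subcode_r_def)
  have c: "CARD('m) * d \<in> G" if d: "d \<in> Dc" for d
  proof -
    obtain J where J: "vec.subspace J" "i \<le> mat.dim (subcode_c C J)" "d = vec.dim J"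
      using d by (auto simp: Dc_def)
    then show ?thesis
      unfolding G_def using optimal_anticode_subcode_c[OF J(1) assms(2)] dim_subcode_c_UNIV[OF J(1), where 'm = 'm]
      by (auto simp: cap intro!: exI[of _ "subcode_c UNIV J"])
  qed
  have r: "CARD('m) * d \<in> G" if d: "d \<in> Dr" and nm: "CARD('n) = CARD('m)" for d
  proof -
    obtain K where K: "vec.subspace K" "i \<le> mat.dim (subcode_r C K)" "d = vec.dim K"
      using d by (auto simp: Dr_def)
    then show ?thesis
      unfolding G_def using optimal_anticode_subcode_r[OF K(1) nm] dim_subcode_r_UNIV[OF K(1), where 'n = 'n] nm
      by (auto simp: cap intro!: exI[of _ "subcode_r UNIV K"])
  qed
  \<comment> \<open>The classification enters here; the facts \<open>c\<close> and \<open>r\<close>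
    supply the converse inclusions.\<close>
  have G: "g \<in> (*) CARD('m) ` Dc \<or> CARD('n) = CARD('m) \<and> g \<in> (*) CARD('m) ` Dr" if g: "g \<in> G" for g
  proof -
    obtain A where A: "g = mat.dim A" "optimal_anticode A" "i \<le> mat.dim (C \<inter> A)"
      using g by (auto simp: G_def)
    from optimal_anticode_classification[OF A(2) assms(1,2)] show ?thesis
    proof (elim disjE conjE exE)
      fix J assume J: "vec.subspace J" "A = subcode_c UNIV J"
      then have "vec.dim J \<in> Dc" using A(3) by (auto simp: Dc_def cap)
      then show ?thesis using A(1) J dim_subcode_c_UNIV[OF J(1), where 'm = 'm] by auto
    next
      fix K assume nm: "CARD('n) = CARD('m)" and K: "vec.subspace K" "A = subcode_r UNIV K"
      then have "vec.dim K \<in> Dr" using A(3) by (auto simp: Dr_def cap)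
      then show ?thesis using A(1) K dim_subcode_r_UNIV[OF K(1), where 'n = 'n] nm by auto
    qed
  qed
  \<comment> \<open>Multiplication by \<open>CARD('m)\<close> is monotone, so it commutes with
    \<open>Min\<close> and cancels against the division in \<open>gen_weight\<close>.\<close>
  have Min: "gen_weight C i = real (Min S)" if "G = (*) CARD('m) ` S" "finite S" "S \<noteq> {}" for S
  proof -
    have "Min G = CARD('m) * Min S"
      using mono_Min_commute[of "(*) CARD('m)" S] that by (simp add: mono_def)
    then show ?thesis by (simp add: gen_weight_def G_def)
  qed
  show ?thesis
  proof (intro conjI impI)
    assume "CARD('n) < CARD('m)"
    then have "G = (*) CARD('m) ` Dc" using G c by auto
    from Min[OF this D(1,2)] show "gen_weight C i = gen_weight_c C i"
      by (simp add: gen_weight_c_eq Dc_def)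
  next
    assume "CARD('m) = CARD('n)"
    then have "G = (*) CARD('m) ` (Dc \<union> Dr)" using G c r by (auto simp: image_Un)
    from Min[OF this] D have "gen_weight C i = real (min (Min Dc) (Min Dr))"
      by (simp add: Min_Un)
    then show "gen_weight C i = min (gen_weight_c C i) (gen_weight_r C i)"
      by (simp add: gen_weight_c_eq gen_weight_r_eq Dc_def Dr_def of_nat_min)
  qed
qed

end
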